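(* Let $G$ be a connected graph of order $n\ge 2$ and let $\mathcal{H}=\{H_1,\dots,H_n\}$ be a family of $n$ connected non-trivial graphs. If for every $H_i\in\mathcal{H}$ it holds that $D(H_i)\ge 6$ or $H_i$ is a cycle graph of order greater than or equal to seven, then for any $k\in\{1,\dots,\mathcal{C}(\mathcal{H})\}$, $$\dim_k(G\odot\mathcal{H})=\dim_k(G\odot\overline{\mathcal{H}})=\sum_{i=1}^{n}\dim_k(K_1+H_i).$$
   Context: All graphs are finite, simple and undirected; a graph is non-trivial if it has at least two vertices. $D(H)$ is the diameter of $H$. $K_1+H$ is the join graph: $H$ together with one new vertex adjacent to every vertex of $H$. For a connected graph $\Gamma$, $d_\Gamma(x,y)$ is the length of a shortest path between $x$ and $y$. For a positive integer $k$, a set $S\subseteq V(\Gamma)$ is a $k$-metric generator for $\Gamma$ if for any two different vertices $u,v$ of $\Gamma$ there are at least $k$ vertices $w\in S$ with $d_\Gamma(u,w)\neq d_\Gamma(v,w)$. A $k$-metric basis is a $k$-metric generator of minimum cardinality, and its cardinality is the $k$-metric dimension $\dim_k(\Gamma)$. Corona product: if $G$ has vertices $v_1,\dots,v_n$ and $\mathcal{H}=\{H_1,\dots,H_n\}$ is a family of $n$ graphs (repetitions up to isomorphism allowed), $G\odot\mathcal{H}$ is obtained from the disjoint union of $G$ and $H_1,\dots,H_n$ by joining, for each $i$, the vertex $v_i$ by an edge to every vertex of $H_i$. $\overline{\mathcal{H}}=\{\overline{H}_1,\dots,\overline{H}_n\}$ is the family of the complement graphs. For a non-trivial graph $H$,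 $N_H(x)$ is the open neighborhood of $x$, $\triangledown$ is the symmetric difference of sets, and $$\mathcal{C}(H)=\min_{x,y\in V(H),\,x\ne y}\left|(N_H(x)\triangledown N_H(y))\cup\{x,y\}\right|,\qquad \mathcal{C}(\mathcal{H})=\min_{H_i\in\mathcal{H}}\mathcal{C}(H_i).$$ *)

theory Defs
  imports Graph_Theory.Graph_Theory
begin

text \<open>
  A finite simple undirected graph is a \<^locale>\<open>pair_graph\<close>: a finite symmetric loop-free
  digraph whose arcs are pairs of vertices, each edge being represented by its two orientations.
\<close>

definition gdist :: "'a pair_pre_digraph \<Rightarrow> 'a \<Rightarrow> 'a \<Rightarrow> ereal" where
  "gdist G u v = wf_digraph.\<mu> (with_proj G) (\<lambda>_. 1) u v"

definition gdiameter :: "'a pair_pre_digraph \<Rightarrow> ereal" where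
  "gdiameter G = (SUP (u, v) \<in> pverts G \<times> pverts G. gdist G u v)"

definition gcomplement :: "'a pair_pre_digraph \<Rightarrow> 'a pair_pre_digraph" where
  "gcomplement G =
    \<lparr> pverts = pverts G,
      parcs = {(u, v). u \<in> pverts G \<and> v \<in> pverts G \<and> u \<noteq> v \<and> (u, v) \<notin> parcs G} \<rparr>"

definition cycle_graph :: "nat \<Rightarrow> nat pair_pre_digraph" where
  "cycle_graph m =
    \<lparr> pverts = {0..<m},
      parcs = {(i, j). i < m \<and> j < m \<and> (j = Suc i mod m \<or> i = Suc j mod m)} \<rparr>"

text \<open>The join with a single vertex: \<^const>\<open>None\<close> is the new vertex.\<close>

definition join_K1 :: "'a pair_pre_digraph \<Rightarrow> 'a option pair_pre_digraph" where
  "join_K1 H =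
    \<lparr> pverts = insert None (Some ` pverts H),
      parcs = {(Some x, Some y) | x y. (x, y) \<in> parcs H}
        \<union> {(None, Some x) | x. x \<in> pverts H}
        \<union> {(Some x, None) | x. x \<in> pverts H} \<rparr>"

text \<open>
  The family is indexed by the vertices of \<open>G\<close>; the vertex \<open>x\<close> of the graph attached to \<open>v\<close>
  becomes \<open>Inr (v, x)\<close>, so the attached graphs are disjoint even if the \<open>H v\<close> share vertices.
\<close>

definition corona ::
  "'a pair_pre_digraph \<Rightarrow> ('a \<Rightarrow> 'b pair_pre_digraph) \<Rightarrow> ('a + 'a \<times> 'b) pair_pre_digraph" where
  "corona G H =
    \<lparr> pverts = Inl ` pverts G \<union> Inr ` (SIGMA v : pverts G. pverts (H v)),
      parcs = {(Inl u, Inl v) | u v. (u, v) \<in> parcs G}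
        \<union> {(Inr (v, x), Inr (v, y)) | v x y. v \<in> pverts G \<and> (x, y) \<in> parcs (H v)}
        \<union> {(Inl v, Inr (v, x)) | v x. v \<in> pverts G \<and> x \<in> pverts (H v)}
        \<union> {(Inr (v, x), Inl v) | v x. v \<in> pverts G \<and> x \<in> pverts (H v)} \<rparr>"

definition k_metric_generator :: "nat \<Rightarrow> 'a pair_pre_digraph \<Rightarrow> 'a set \<Rightarrow> bool" where
  "k_metric_generator k G S \<longleftrightarrow>
    S \<subseteq> pverts G \<and>
    (\<forall>u \<in> pverts G. \<forall>v \<in> pverts G. u \<noteq> v \<longrightarrow>
      k \<le> card {w \<in> S. gdist G u w \<noteq> gdist G v w})"

definition k_metric_basis :: "nat \<Rightarrow> 'a pair_pre_digraph \<Rightarrow> 'a set \<Rightarrow> bool" where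
  "k_metric_basis k G S \<longleftrightarrow>
    k_metric_generator k G S \<and> (\<forall>T. k_metric_generator k G T \<longrightarrow> card S \<le> card T)"

text \<open>Unspecified if the graph has no \<open>k\<close>-metric generator.\<close>

definition k_metric_dim :: "nat \<Rightarrow> 'a pair_pre_digraph \<Rightarrow> nat" where
  "k_metric_dim k G = (THE n. \<exists>S. k_metric_basis k G S \<and> card S = n)"

definition open_nbhd :: "'a pair_pre_digraph \<Rightarrow> 'a \<Rightarrow> 'a set" where
  "open_nbhd G x = {y. (x, y) \<in> parcs G}"

definition C_graph :: "'a pair_pre_digraph \<Rightarrow> nat" where
  "C_graph H =
    Min {card (sym_diff (open_nbhd H x) (open_nbhd H y) \<union> {x, y}) | x y.
      x \<in> pverts H \<and> y \<in> pverts H \<and> x \<noteq> y}"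

definition C_family :: "'a set \<Rightarrow> ('a \<Rightarrow> 'b pair_pre_digraph) \<Rightarrow> nat" where
  "C_family I H = Min ((\<lambda>i. C_graph (H i)) ` I)"

end

theory Submission
  imports Defs
begin

text \<open>
  The three dimensions are compared with one purely local invariant. Inside a copy of \<open>H\<close> all of
  whose vertices have a common neighbour outside, distances are truncated at \<open>2\<close>, so a vertex
  distinguishes \<open>x\<close> from \<open>y\<close> exactly if it lies in
  \<open>(N(x) \<triangle> N(y)) \<union> {x, y}\<close>. Call \<open>A \<subseteq> V(H)\<close> a \<open>k\<close>-adjacency generator if it meets every such set in
  at least \<open>k\<close> vertices, and let \<open>adim\<^sub>k(H)\<close> be the least size of one; generators exist
  as soon as \<open>k\<close> is at most the smallest size of these sets.

  In a corona product a vertex outside the copy of \<open>H v\<close> is equally far from all vertices of that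
  copy. Hence a \<open>k\<close>-metric generator induces a \<open>k\<close>-adjacency generator on each copy. Conversely,
  the union of \<open>k\<close>-adjacency generators of the copies is a \<open>k\<close>-metric generator: two
  vertices that do not lie in the same copy are distinguished by the whole part of the union in a
  suitable copy, which has at least \<open>k\<close> elements. So \<open>dim\<^sub>k\<close> of a corona product is the sum
  of the \<open>adim\<^sub>k(H v)\<close> (\<open>k_metric_dim_corona\<close>). Complementation does not change the sets
  \<open>(N(x) \<triangle> N(y)) \<union> {x, y}\<close>, which gives the first equation.

  In the join \<open>K\<^sub>1 + H\<close> the same argument works except for pairs consisting of the hub and a vertex
  \<open>x\<close> of \<open>H\<close>: these are distinguished by the vertices outside \<open>N(x)\<close>. If there are \<open>a \<noteq> b\<close> with
  \<open>(N(a) \<triangle> N(b)) \<union> {a, b}\<close> disjoint from \<open>N(x)\<close>, an adjacency generator contains \<open>k\<close> such vertices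
  anyway, and \<open>dim\<^sub>k(K\<^sub>1 + H) = adim\<^sub>k(H)\<close> (\<open>k_metric_dim_join_K1\<close>). Any two distinct vertices
  that \<open>x\<close> cannot reach by a walk of length \<open>1\<close> or \<open>2\<close> will do. On a long cycle there are such
  vertices opposite to \<open>x\<close>. If the diameter is at least \<open>6\<close>, two vertices \<open>u\<close> and \<open>v\<close> at
  distance at least \<open>6\<close> will do unless one of them is close to \<open>x\<close>, and in that case the other
  one and any of its neighbours are far from \<open>x\<close>.
\<close>

section \<open>Distances by potentials\<close>

text \<open>
  A certificate that \<open>f\<close> is the distance to \<open>t\<close>: an arc decreases \<open>f\<close> by at most one, which bounds
  the length of every walk to \<open>t\<close> from below, and from every other vertex some arc decreases it by
  one, which yields a walk of that length. Checking it is local, so distances in coronas and joins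
  can be computed without handling walks.
\<close>

definition distance_to :: "'a pair_pre_digraph \<Rightarrow> 'a \<Rightarrow> ('a \<Rightarrow> nat) \<Rightarrow> bool" where
  "distance_to G t f \<longleftrightarrow> f t = 0 \<and> (\<forall>(u, w) \<in> parcs G. f u \<le> Suc (f w)) \<and>
    (\<forall>u \<in> pverts G. u \<noteq> t \<longrightarrow> (\<exists>w. (u, w) \<in> parcs G \<and> f u = Suc (f w)))"

lemma (in wf_digraph) awalk_cost_unit: "awalk_cost (\<lambda>_. 1) p = real (length p)"
  by (induct p) simp_all

lemma relpow_imp_awalk:
  assumes "pair_wf_digraph G" "(u, v) \<in> parcs G ^^ n" "u \<in> pverts G"
  shows "\<exists>p. pre_digraph.awalk (with_proj G) u p v \<and> length p = n"
  using assms(2,3)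
proof (induct n arbitrary: u)
  case 0
  then show ?case by (auto simp: pre_digraph.awalk_def pre_digraph.cas.simps)
next
  case (Suc n)
  then obtain w where w: "(u, w) \<in> parcs G" "(w, v) \<in> parcs G ^^ n"
    by (meson relpow_Suc_D2)
  then have "w \<in> pverts G"
    using assms(1) by (auto dest: pair_wf_digraph.in_arcsD2)
  then obtain p where "pre_digraph.awalk (with_proj G) w p v" "length p = n"
    using Suc w by blast
  then have "pre_digraph.awalk (with_proj G) u ((u, w) # p) v \<and> length ((u, w) # p) = Suc n"
    using w Suc by (auto simp: pre_digraph.awalk_def pre_digraph.cas.simps)
  then show ?case by blast
qed

lemma gdist_le_relpow:
  assumes "pair_wf_digraph G" "(u, v) \<in> parcs G ^^ n" "u \<in> pverts G"
  shows "gdist G u v \<le> ereal (real n)"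
proof -
  interpret wf_digraph "with_proj G" using assms(1) by (simp add: wf_digraph_wp_iff)
  obtain p where "awalk u p v" "length p = n"
    using relpow_imp_awalk[OF assms] by blast
  then show ?thesis
    using min_cost_le_walk_cost[of u p v "\<lambda>_. 1"]
    by (simp add: gdist_def awalk_cost_unit)
qed

lemma distance_to_relpow:
  assumes wf: "pair_wf_digraph G" and f: "distance_to G t f" and u: "u \<in> pverts G"
  shows "(u, t) \<in> parcs G ^^ f u"
  using u
proof (induct "f u" arbitrary: u)
  case 0
  then show ?case using f by (auto simp: distance_to_def)
next
  case (Suc n)
  then have "u \<noteq> t" using f by (auto simp: distance_to_def)
  then obtain w where w: "(u, w) \<in> parcs G" "f u = Suc (f w)"
    using f Suc by (auto simp: distance_to_def)
  then have "w \<in> pverts G" using wf by (auto dest: pair_wf_digraph.in_arcsD2)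
  then have "(w, t) \<in> parcs G ^^ f w" using Suc w by simp
  then show ?case using w by (metis relpow_Suc_I2)
qed

lemma gdist_eqI:
  assumes wf: "pair_wf_digraph G" and f: "distance_to G t f" and u: "u \<in> pverts G"
  shows "gdist G u t = ereal (real (f u))"
proof (rule antisym)
  show "gdist G u t \<le> ereal (real (f u))"
    using gdist_le_relpow[OF wf distance_to_relpow[OF wf f u] u] .
next
  interpret wf_digraph "with_proj G" using wf by (simp add: wf_digraph_wp_iff)
  have "f u \<le> length p" if "awalk u p t" for p
    using that
  proof (induct p arbitrary: u)
    case Nil
    then show ?case using f by (auto simp: awalk_def distance_to_def)
  next
    case (Cons e p)
    then have "awalk (snd e) p t" "(u, snd e) \<in> parcs G"
      by (auto simp: awalk_Cons_iff)
    then show ?case using Cons.hyps[of "snd e"] f by (force simp: distance_to_def)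
  qed
  then show "ereal (real (f u)) \<le> gdist G u t"
    unfolding gdist_def \<mu>_def by (auto intro!: INF_greatest simp: awalk_cost_unit)
qed

lemma connected_rtrancl:
  assumes G: "pair_graph G" "connected (with_proj G)" and "u \<in> pverts G" "v \<in> pverts G"
  shows "(u, v) \<in> (parcs G)\<^sup>*"
proof -
  interpret pair_graph G by fact
  have "u \<rightarrow>\<^sup>*\<^bsub>with_proj (mk_symmetric G)\<^esub> v"
    using assms by (auto simp: connected_def strongly_connected_def)
  then have "u \<rightarrow>\<^sup>*\<^bsub>with_proj G\<^esub> v"
    using reachable_mk_symmetric_eq sym_arcs by metis
  then show ?thesis
    unfolding reachable_def by (auto dest: rtrancl_on_rtranclI)
qed

text \<open>
  The base graph of a corona is arbitrary, so its distances enter only through some potential, here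
  the least length of a walk to \<open>t\<close>.
\<close>

lemma ex_distance_to:
  assumes G: "pair_graph G" "connected (with_proj G)" and t: "t \<in> pverts G"
  shows "\<exists>f. distance_to G t f"
proof -
  interpret pair_graph G by fact
  define f where "f u = (LEAST n. (u, t) \<in> parcs G ^^ n)" for u
  have reach: "(u, t) \<in> parcs G ^^ f u" if "u \<in> pverts G" for u
    using connected_rtrancl[OF G that t] unfolding f_def rtrancl_power by (auto intro: LeastI)
  have least: "f u \<le> n" if "(u, t) \<in> parcs G ^^ n" for u n
    unfolding f_def using that by (rule Least_le)
  have lip: "f u \<le> Suc (f w)" if "(u, w) \<in> parcs G" for u w
    using least[OF relpow_Suc_I2[OF that reach]] that by (auto dest: in_arcsD2)
  have "\<exists>w. (u, w) \<in> parcs G \<and> f u = Suc (f w)" if u: "u \<in> pverts G" "u \<noteq> t" for u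
  proof (cases "f u")
    case 0
    then show ?thesis using reach[OF u(1)] u(2) by simp
  next
    case (Suc n)
    then obtain w where w: "(u, w) \<in> parcs G" "(w, t) \<in> parcs G ^^ n"
      using reach[OF u(1)] by (metis relpow_Suc_D2)
    then have "f w \<le> n" "f u \<le> Suc (f w)" using least lip by auto
    then show ?thesis using w Suc by auto
  qed
  moreover have "f t = 0" using least[of t 0] by simp
  ultimately have "distance_to G t f" using lip by (auto simp: distance_to_def)
  then show ?thesis by blast
qed

section \<open>Adjacency generators\<close>

text \<open>
  The set of vertices that distinguish \<open>x\<close> from \<open>y\<close> at truncated distance; \<^const>\<open>C_graph\<close> is its least
  size over distinct \<open>x\<close> and \<open>y\<close>.
\<close>

definition adj_diff :: "'a pair_pre_digraph \<Rightarrow> 'a \<Rightarrow> 'a \<Rightarrow> 'a set" where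
  "adj_diff H x y = sym_diff (open_nbhd H x) (open_nbhd H y) \<union> {x, y}"

definition k_adj_generator :: "nat \<Rightarrow> 'a pair_pre_digraph \<Rightarrow> 'a set \<Rightarrow> bool" where
  "k_adj_generator k H A \<longleftrightarrow> A \<subseteq> pverts H \<and>
    (\<forall>x \<in> pverts H. \<forall>y \<in> pverts H. x \<noteq> y \<longrightarrow> k \<le> card (A \<inter> adj_diff H x y))"

text \<open>
  Meaningful only if there is a \<open>k\<close>-adjacency generator at all, that is, if all vertices form one.
\<close>

definition k_adj_dim :: "nat \<Rightarrow> 'a pair_pre_digraph \<Rightarrow> nat" where
  "k_adj_dim k H = (LEAST n. \<exists>A. k_adj_generator k H A \<and> card A = n)"

text \<open>
  The distance truncated at \<open>2\<close>, which is the distance of vertices of \<open>H\<close> in every graph that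
  contains \<open>H\<close> as an induced subgraph with a common neighbour of all its vertices outside.
\<close>

definition dist2 :: "'a pair_pre_digraph \<Rightarrow> 'a \<Rightarrow> 'a \<Rightarrow> nat" where
  "dist2 H x y = (if x = y then 0 else if (x, y) \<in> parcs H then 1 else 2)"

lemma dist2_le: "dist2 H x y \<le> 2"
  by (simp add: dist2_def)

lemma dist2_neq_iff:
  "x \<noteq> y \<Longrightarrow> dist2 H x w \<noteq> dist2 H y w \<longleftrightarrow> w \<in> adj_diff H x y"
  by (auto simp: dist2_def adj_diff_def open_nbhd_def)

lemma k_adj_dim_le: "k_adj_generator k H A \<Longrightarrow> k_adj_dim k H \<le> card A"
  unfolding k_adj_dim_def by (rule Least_le) blast

lemma k_adj_dim_attained:
  assumes "k_adj_generator k H B"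
  obtains A where "k_adj_generator k H A" "card A = k_adj_dim k H"
proof -
  have "\<exists>A. k_adj_generator k H A \<and> card A = k_adj_dim k H"
    unfolding k_adj_dim_def by (rule LeastI) (use assms in blast)
  then show ?thesis using that by blast
qed

lemma k_metric_dim_eqI:
  assumes "k_metric_generator k G S" "card S = n"
    and "\<And>T. k_metric_generator k G T \<Longrightarrow> n \<le> card T"
  shows "k_metric_dim k G = n"
  unfolding k_metric_dim_def
proof (rule the_equality)
  show "\<exists>S. k_metric_basis k G S \<and> card S = n"
    using assms by (auto simp: k_metric_basis_def)
next
  fix m assume "\<exists>S. k_metric_basis k G S \<and> card S = m"
  then show "m = n"
    using assms by (auto simp: k_metric_basis_def intro: antisym)
qed

lemma k_adj_generator_pverts:
  assumes H: "pair_graph H" and k: "k \<le> C_graph H"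
  shows "k_adj_generator k H (pverts H)"
  unfolding k_adj_generator_def
proof (intro conjI ballI impI)
  fix x y assume xy: "x \<in> pverts H" "y \<in> pverts H" "x \<noteq> y"
  interpret pair_graph H by fact
  let ?M = "{card (sym_diff (open_nbhd H x) (open_nbhd H y) \<union> {x, y}) | x y.
      x \<in> pverts H \<and> y \<in> pverts H \<and> x \<noteq> y}"
  have "?M \<subseteq> (\<lambda>(x, y). card (adj_diff H x y)) ` (pverts H \<times> pverts H)"
    unfolding adj_diff_def by auto
  then have "finite ?M" by (rule finite_subset) (simp add: pair_finite_verts)
  moreover have "card (adj_diff H x y) \<in> ?M" using xy unfolding adj_diff_def by blast
  ultimately have "C_graph H \<le> card (adj_diff H x y)"
    unfolding C_graph_def by (rule Min_le)
  moreover have "pverts H \<inter> adj_diff H x y = adj_diff H x y"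
    using xy by (auto simp: adj_diff_def open_nbhd_def dest: in_arcsD2)
  ultimately show "k \<le> card (pverts H \<inter> adj_diff H x y)" using k by simp
qed simp

lemma pverts_gcomplement [simp]: "pverts (gcomplement H) = pverts H"
  by (simp add: gcomplement_def)

lemma pair_graph_gcomplement:
  assumes "pair_graph H"
  shows "pair_graph (gcomplement H)"
proof -
  interpret pair_graph H by fact
  have "finite (parcs (gcomplement H))"
    by (rule finite_subset[of _ "pverts H \<times> pverts H"])
      (auto simp: gcomplement_def pair_finite_verts)
  then show ?thesis
    by unfold_locales
      (auto simp: gcomplement_def pair_finite_verts symmetric_def sym_def dest: arcs_symmetric)
qed

text \<open>
  A third vertex is adjacent in the complement to exactly one of \<open>x\<close> and \<open>y\<close> iff it is so in \<open>H\<close>,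
  and the vertices \<open>x\<close> and \<open>y\<close> themselves, where the two neighbourhoods behave differently, belong to
  both sets.
\<close>

lemma adj_diff_gcomplement:
  assumes "pair_graph H" "x \<in> pverts H" "y \<in> pverts H"
  shows "adj_diff (gcomplement H) x y = adj_diff H x y"
proof -
  interpret pair_graph H by fact
  show ?thesis
    using assms(2,3) by (auto simp: adj_diff_def open_nbhd_def gcomplement_def dest: in_arcsD2)
qed

lemma k_adj_generator_gcomplement:
  assumes "pair_graph H"
  shows "k_adj_generator k (gcomplement H) = k_adj_generator k H"
proof
  fix A
  show "k_adj_generator k (gcomplement H) A = k_adj_generator k H A"
    using adj_diff_gcomplement[OF assms] by (simp add: k_adj_generator_def)
qed

section \<open>Corona products\<close>

lemma pair_wf_corona:
  assumes "pair_wf_digraph G" "\<And>v. v \<in> pverts G \<Longrightarrow> pair_wf_digraph (H v)"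
  shows "pair_wf_digraph (corona G H)"
proof -
  note arcs = pair_wf_digraph.in_arcsD1[OF assms(1)] pair_wf_digraph.in_arcsD2[OF assms(1)]
    pair_wf_digraph.in_arcsD1[OF assms(2)] pair_wf_digraph.in_arcsD2[OF assms(2)]
  show ?thesis
    by unfold_locales (auto simp: corona_def dest: arcs)
qed

lemma distance_to_corona_Inl:
  assumes "distance_to G w f"
  shows "distance_to (corona G H) (Inl w) (case_sum f (\<lambda>(v, x). Suc (f v)))"
    (is "distance_to ?C ?t ?g")
  unfolding distance_to_def
proof (intro conjI ballI impI)
  show "?g ?t = 0" using assms by (simp add: distance_to_def)
next
  fix e assume "e \<in> parcs ?C"
  then show "case e of (a, b) \<Rightarrow> ?g a \<le> Suc (?g b)"
    using assms by (auto simp: corona_def distance_to_def)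
next
  fix a assume a: "a \<in> pverts ?C" "a \<noteq> ?t"
  show "\<exists>b. (a, b) \<in> parcs ?C \<and> ?g a = Suc (?g b)"
  proof (cases a)
    case (Inl v)
    then obtain u where "(v, u) \<in> parcs G" "f v = Suc (f u)"
      using assms a by (auto simp: distance_to_def corona_def)
    then show ?thesis
      using Inl by (intro exI[of _ "Inl u"]) (auto simp: corona_def)
  next
    case (Inr b)
    then show ?thesis
      using a by (intro exI[of _ "Inl (fst b)"]) (auto simp: corona_def)
  qed
qed

text \<open>
  A walk to \<open>(w, y)\<close> from outside the copy of \<open>H w\<close> enters it through \<open>w\<close>, at the cost of one final
  step; within the copy, the detour over \<open>w\<close> joins non-adjacent vertices by two steps.
\<close>

lemma distance_to_corona_Inr:
  assumes f: "distance_to G w f" and y: "w \<in> pverts G" "y \<in> pverts (H w)"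
  shows "distance_to (corona G H) (Inr (w, y))
    (case_sum (\<lambda>v. Suc (f v)) (\<lambda>(v, x). if v = w then dist2 (H w) x y else Suc (Suc (f v))))"
    (is "distance_to ?C ?t ?g")
  unfolding distance_to_def
proof (intro conjI ballI impI)
  show "?g ?t = 0" by (simp add: dist2_def)
next
  fix e assume "e \<in> parcs ?C"
  then show "case e of (a, b) \<Rightarrow> ?g a \<le> Suc (?g b)"
    using f by (auto simp: corona_def distance_to_def dist2_def)
next
  fix a assume a: "a \<in> pverts ?C" "a \<noteq> ?t"
  show "\<exists>b. (a, b) \<in> parcs ?C \<and> ?g a = Suc (?g b)"
  proof (cases a)
    case (Inl v)
    then have v: "v \<in> pverts G" using a by (auto simp: corona_def)
    show ?thesis
    proof (cases "v = w")
      case True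
      then show ?thesis
        using Inl y f by (intro exI[of _ ?t]) (auto simp: corona_def distance_to_def dist2_def)
    next
      case False
      then obtain u where "(v, u) \<in> parcs G" "f v = Suc (f u)"
        using f v by (auto simp: distance_to_def)
      then show ?thesis
        using Inl by (intro exI[of _ "Inl u"]) (auto simp: corona_def)
    qed
  next
    case (Inr b)
    then obtain v x where b: "a = Inr (v, x)" "v \<in> pverts G" "x \<in> pverts (H v)"
      using a by (auto simp: corona_def)
    show ?thesis
    proof (cases "v = w \<and> (x, y) \<in> parcs (H w)")
      case True
      then show ?thesis
        using b a y by (intro exI[of _ ?t]) (auto simp: corona_def dist2_def)
    next
      case False
      then show ?thesis
        using b a y f
        by (intro exI[of _ "Inl v"]) (auto simp: corona_def dist2_def distance_to_def)
    qed
  qed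
qed

text \<open>
  The part of a \<open>k\<close>-metric generator in each copy is a \<open>k\<close>-adjacency generator, and optimal choices in
  the copies combine to a \<open>k\<close>-metric generator without any vertex of \<open>G\<close>. A second vertex of \<open>G\<close> is
  essential: only its copy is sure to distinguish \<open>v\<close> from the vertices of the copy at \<open>v\<close>.
\<close>

theorem k_metric_dim_corona:
  assumes G: "pair_graph G" "connected (with_proj G)" "2 \<le> card (pverts G)"
    and H: "\<And>v. v \<in> pverts G \<Longrightarrow> pair_graph (H v)"
      "\<And>v. v \<in> pverts G \<Longrightarrow> 2 \<le> card (pverts (H v))"
      "\<And>v. v \<in> pverts G \<Longrightarrow> \<exists>A. k_adj_generator k (H v) A"
  shows "k_metric_dim k (corona G H) = (\<Sum>v \<in> pverts G. k_adj_dim k (H v))"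
proof -
  let ?C = "corona G H" and ?V = "pverts G"
  interpret G: pair_graph G by fact
  have finV: "finite ?V" by (rule G.pair_finite_verts)
  have finH: "finite (pverts (H v))" if "v \<in> ?V" for v
    using H(1)[OF that] pair_fin_digraph.pair_finite_verts[of "H v"]
    by (simp add: pair_graph_def pair_digraph_def)
  have wf: "pair_wf_digraph ?C"
    using H(1) by (intro pair_wf_corona)
      (auto simp: pair_graph_def pair_digraph_def pair_fin_digraph_def intro: G.pair_wf_digraph)
  have "\<forall>w \<in> ?V. \<exists>f. distance_to G w f"
    using ex_distance_to[OF G(1,2)] by blast
  then obtain F where F: "\<And>w. w \<in> ?V \<Longrightarrow> distance_to G w (F w)"
    by metis
  have F_pos: "0 < F w v" if "v \<in> ?V" "w \<in> ?V" "v \<noteq> w" for v w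
    using F[of w] that by (force simp: distance_to_def)
  have F_0: "F w w = 0" if "w \<in> ?V" for w
    using F[of w] that by (simp add: distance_to_def)
  have mem [simp]: "Inl v \<in> pverts ?C \<longleftrightarrow> v \<in> ?V"
    "Inr (v, x) \<in> pverts ?C \<longleftrightarrow> v \<in> ?V \<and> x \<in> pverts (H v)" for v x
    by (auto simp: corona_def)
  have d_rl: "gdist ?C (Inr (v, x)) (Inl w) = ereal (Suc (F w v))"
    if "v \<in> ?V" "w \<in> ?V" "x \<in> pverts (H v)" for v w x
    using gdist_eqI[OF wf distance_to_corona_Inl[OF F], of w "Inr (v, x)"] that by simp
  have d_lr: "gdist ?C (Inl v) (Inr (w, y)) = ereal (Suc (F w v))"
    if "v \<in> ?V" "w \<in> ?V" "y \<in> pverts (H w)" for v w y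
    using gdist_eqI[OF wf distance_to_corona_Inr[OF F], of w y "Inl v"] that by simp
  have d_rr: "gdist ?C (Inr (v, x)) (Inr (w, y)) =
      ereal (if v = w then dist2 (H w) x y else Suc (Suc (F w v)))"
    if "v \<in> ?V" "w \<in> ?V" "x \<in> pverts (H v)" "y \<in> pverts (H w)" for v w x y
    using gdist_eqI[OF wf distance_to_corona_Inr[OF F], of w y "Inr (v, x)"] that by simp
  \<comment> \<open>Only vertices of the copy itself distinguish two of its vertices, and they see truncated distances.\<close>
  have trace: "{z \<in> S. gdist ?C (Inr (v, x)) z \<noteq> gdist ?C (Inr (v, y)) z} =
      (\<lambda>z. Inr (v, z)) ` ({z. Inr (v, z) \<in> S} \<inter> adj_diff (H v) x y)"
    if S: "S \<subseteq> pverts ?C" and v: "v \<in> ?V" and xy: "x \<in> pverts (H v)" "y \<in> pverts (H v)" "x \<noteq> y"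
    for S v x y
  proof -
    have "gdist ?C (Inr (v, x)) z \<noteq> gdist ?C (Inr (v, y)) z \<longleftrightarrow>
        (\<exists>z'. z = Inr (v, z') \<and> z' \<in> adj_diff (H v) x y)" if z: "z \<in> S" for z
    proof (cases z)
      case (Inl w)
      then have "w \<in> ?V" using S z by auto
      then show ?thesis using Inl v xy by (simp add: d_rl)
    next
      case (Inr b)
      then obtain w z' where "z = Inr (w, z')" "w \<in> ?V" "z' \<in> pverts (H w)"
        using S z by (cases b) auto
      then show ?thesis using v xy by (auto simp: d_rr dist2_neq_iff[symmetric])
    qed
    then show ?thesis by auto
  qed
  have "\<forall>v \<in> ?V. \<exists>A. k_adj_generator k (H v) A \<and> card A = k_adj_dim k (H v)"
    using H(3) k_adj_dim_attained by metis
  then obtain A where A: "\<And>v. v \<in> ?V \<Longrightarrow> k_adj_generator k (H v) (A v)"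
    and card_A: "\<And>v. v \<in> ?V \<Longrightarrow> card (A v) = k_adj_dim k (H v)"
    by metis
  have A_sub: "A v \<subseteq> pverts (H v)" if "v \<in> ?V" for v
    using A[OF that] by (simp add: k_adj_generator_def)
  \<comment> \<open>Distinguishing any two vertices of \<open>H v\<close> already takes \<open>k\<close> elements of \<open>A v\<close>.\<close>
  have k_le_A: "k \<le> card (A v)" if v: "v \<in> ?V" for v
  proof -
    obtain x y where "x \<in> pverts (H v)" "y \<in> pverts (H v)" "x \<noteq> y"
      using H(2)[OF v] finH[OF v] by (metis card_le_Suc0_iff_eq not_less_eq_eq numeral_2_eq_2)
    then have "k \<le> card (A v \<inter> adj_diff (H v) x y)"
      using A[OF v] by (simp add: k_adj_generator_def)
    also have "\<dots> \<le> card (A v)"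
      using A_sub[OF v] finH[OF v] by (intro card_mono) (auto intro: finite_subset)
    finally show ?thesis .
  qed
  let ?S = "Inr ` (SIGMA v : ?V. A v) :: ('a + 'a \<times> 'b) set"
  have finA: "finite (A v)" if "v \<in> ?V" for v
    using A_sub[OF that] finH[OF that] by (rule finite_subset)
  have finS: "finite ?S" using finV finA by auto
  have S_sub: "?S \<subseteq> pverts ?C" by (auto intro: subsetD[OF A_sub])
  have block: "k \<le> card {z \<in> ?S. gdist ?C a z \<noteq> gdist ?C b z}"
    if v: "v \<in> ?V" and sep: "\<And>z. z \<in> A v \<Longrightarrow> gdist ?C a (Inr (v, z)) \<noteq> gdist ?C b (Inr (v, z))"
    for v a b
  proof -
    have "k \<le> card ((\<lambda>z. Inr (v, z) :: 'a + 'a \<times> 'b) ` A v)"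
      using k_le_A[OF v] by (simp add: card_image inj_on_def)
    also have "\<dots> \<le> card {z \<in> ?S. gdist ?C a z \<noteq> gdist ?C b z}"
      using v sep finS by (intro card_mono) auto
    finally show ?thesis .
  qed
  \<comment> \<open>Every vertex of \<open>G\<close> is nearer to its own copy than any other vertex of \<open>G\<close> is.\<close>
  have sep_ll: "k \<le> card {z \<in> ?S. gdist ?C (Inl v) z \<noteq> gdist ?C (Inl w) z}"
    if "v \<in> ?V" "w \<in> ?V" "v \<noteq> w" for v w
  proof (rule block[OF that(1)])
    fix z assume "z \<in> A v"
    then have "z \<in> pverts (H v)" using A_sub that(1) by blast
    then show "gdist ?C (Inl v) (Inr (v, z)) \<noteq> gdist ?C (Inl w) (Inr (v, z))"
      using that F_pos[of w v] F_0 by (simp add: d_lr)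
  qed
  have sep_lr: "k \<le> card {z \<in> ?S. gdist ?C (Inl v) z \<noteq> gdist ?C (Inr (w, y)) z}"
    if vw: "v \<in> ?V" "w \<in> ?V" "y \<in> pverts (H w)" for v w y
  proof (cases "v = w")
    case True
    \<comment> \<open>Within the copy at \<open>v\<close> both distances may be \<open>1\<close>; seen from another copy, \<open>v\<close> is one step closer.\<close>
    obtain u where u: "u \<in> ?V" "u \<noteq> v"
      using G(3) finV by (metis card_le_Suc0_iff_eq not_less_eq_eq numeral_2_eq_2)
    have "gdist ?C (Inl v) (Inr (u, z)) \<noteq> gdist ?C (Inr (w, y)) (Inr (u, z))" if "z \<in> A u" for z
      using True u vw subsetD[OF A_sub that] by (simp add: d_lr d_rr)
    then show ?thesis by (rule block[OF u(1)])
  next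
    case False
    have "gdist ?C (Inl v) (Inr (v, z)) \<noteq> gdist ?C (Inr (w, y)) (Inr (v, z))" if "z \<in> A v" for z
      using False vw subsetD[OF A_sub that] F_0 by (simp add: d_lr d_rr)
    then show ?thesis by (rule block[OF vw(1)])
  qed
  have sep_rr: "k \<le> card {z \<in> ?S. gdist ?C (Inr (v, x)) z \<noteq> gdist ?C (Inr (w, y)) z}"
    if vw: "v \<in> ?V" "w \<in> ?V" "x \<in> pverts (H v)" "y \<in> pverts (H w)" "(v, x) \<noteq> (w, y)" for v w x y
  proof (cases "v = w")
    case True
    then have "x \<noteq> y" using vw by simp
    have "{z. Inr (v, z) \<in> ?S} = A v" using vw by auto
    then have "card {z \<in> ?S. gdist ?C (Inr (v, x)) z \<noteq> gdist ?C (Inr (v, y)) z} =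
        card (A v \<inter> adj_diff (H v) x y)"
      using trace[OF S_sub vw(1), of x y] vw True \<open>x \<noteq> y\<close> by (simp add: card_image inj_on_def)
    then show ?thesis
      using A[OF vw(1)] vw True \<open>x \<noteq> y\<close> by (simp add: k_adj_generator_def)
  next
    case False
    have "gdist ?C (Inr (v, x)) (Inr (v, z)) \<noteq> gdist ?C (Inr (w, y)) (Inr (v, z))" if "z \<in> A v" for z
      using False vw subsetD[OF A_sub that] F_pos[of w v] dist2_le[of "H v" x z]
      by (simp add: d_rr)
    then show ?thesis by (rule block[OF vw(1)])
  qed
  show ?thesis
  proof (rule k_metric_dim_eqI)
    show "k_metric_generator k ?C ?S"
      unfolding k_metric_generator_def
    proof (intro conjI ballI impI)
      fix a b assume ab: "a \<in> pverts ?C" "b \<in> pverts ?C" "a \<noteq> b"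
      show "k \<le> card {z \<in> ?S. gdist ?C a z \<noteq> gdist ?C b z}"
      proof (cases a)
        case (Inl v)
        then show ?thesis using ab sep_ll sep_lr by (cases b) auto
      next
        case (Inr p)
        then obtain v x where a: "a = Inr (v, x)" "v \<in> ?V" "x \<in> pverts (H v)"
          using ab(1) by (cases p) auto
        show ?thesis
        proof (cases b)
          case (Inl w)
          have "{z \<in> ?S. gdist ?C a z \<noteq> gdist ?C b z} = {z \<in> ?S. gdist ?C b z \<noteq> gdist ?C a z}"
            by auto
          then show ?thesis using sep_lr[of w v x] a ab(2) Inl by simp
        next
          case (Inr q)
          then obtain w y where "b = Inr (w, y)" "w \<in> ?V" "y \<in> pverts (H w)"
            using ab(2) by (cases q) auto
          then show ?thesis using sep_rr[of v w x y] a ab(3) by simp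
        qed
      qed
    qed (use S_sub in simp)
    show "card ?S = (\<Sum>v \<in> ?V. k_adj_dim k (H v))"
      using finV finA card_A by (simp add: card_image)
  next
    fix T assume T: "k_metric_generator k ?C T"
    define B where "B v = {z. Inr (v, z) \<in> T}" for v
    have T_sub: "T \<subseteq> pverts ?C" using T by (simp add: k_metric_generator_def)
    have finT: "finite T"
      by (rule finite_subset[OF T_sub]) (use finV finH in \<open>auto simp: corona_def\<close>)
    have B_sub: "B v \<subseteq> pverts (H v)" for v using T_sub by (auto simp: B_def)
    have "k_adj_generator k (H v) (B v)" if v: "v \<in> ?V" for v
      unfolding k_adj_generator_def
    proof (intro conjI ballI impI)
      fix x y assume xy: "x \<in> pverts (H v)" "y \<in> pverts (H v)" "x \<noteq> y"
      have "k \<le> card {z \<in> T. gdist ?C (Inr (v, x)) z \<noteq> gdist ?C (Inr (v, y)) z}"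
        using T xy v by (simp add: k_metric_generator_def)
      also have "\<dots> = card (B v \<inter> adj_diff (H v) x y)"
        using trace[OF T_sub v xy] by (simp add: card_image inj_on_def B_def)
      finally show "k \<le> card (B v \<inter> adj_diff (H v) x y)" .
    qed (rule B_sub)
    then have "(\<Sum>v \<in> ?V. k_adj_dim k (H v)) \<le> (\<Sum>v \<in> ?V. card (B v))"
      by (intro sum_mono k_adj_dim_le)
    also have "\<dots> = card (Inr ` (SIGMA v : ?V. B v) :: ('a + 'a \<times> 'b) set)"
    proof -
      have "finite (B v)" if "v \<in> ?V" for v
        using B_sub finH[OF that] by (rule finite_subset)
      then show ?thesis using finV by (simp add: card_image)
    qed
    also have "\<dots> \<le> card T"
      using finT by (intro card_mono) (auto simp: B_def)
    finally show "(\<Sum>v \<in> ?V. k_adj_dim k (H v)) \<le> card T" .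
  qed
qed

section \<open>Joins with a single vertex\<close>

text \<open>
  A pair \<open>a, b\<close> is hidden from \<open>x\<close> if no vertex that distinguishes it is adjacent to \<open>x\<close>. Vertices of
  the join that are not adjacent to \<open>x\<close> have a distance to \<open>x\<close> other than \<open>1\<close>, their distance to the
  hub.
\<close>

definition hidden_pairs :: "'a pair_pre_digraph \<Rightarrow> bool" where
  "hidden_pairs H \<longleftrightarrow> (\<forall>x \<in> pverts H. \<exists>a \<in> pverts H. \<exists>b \<in> pverts H.
    a \<noteq> b \<and> adj_diff H a b \<inter> open_nbhd H x = {})"

lemma pair_wf_join_K1:
  assumes "pair_wf_digraph H"
  shows "pair_wf_digraph (join_K1 H)"
  using assms pair_wf_digraph.in_arcsD1 pair_wf_digraph.in_arcsD2
  by unfold_locales (fastforce simp: join_K1_def)+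

lemma distance_to_join_K1_None:
  "distance_to (join_K1 H) None (case_option 0 (\<lambda>_. 1))"
  unfolding distance_to_def join_K1_def by auto

lemma distance_to_join_K1_Some:
  assumes "y \<in> pverts H"
  shows "distance_to (join_K1 H) (Some y) (case_option 1 (\<lambda>x. dist2 H x y))"
  using assms by (auto simp: distance_to_def join_K1_def dist2_def split: option.splits)

text \<open>
  In general a \<open>k\<close>-adjacency generator need not distinguish the hub from a vertex adjacent to almost
  all of the generator; hidden pairs exclude such vertices. The hub itself distinguishes no two vertices of \<open>H\<close>, so
  the lower bound is as for coronas.
\<close>

theorem k_metric_dim_join_K1:
  assumes H: "pair_graph H" and gen: "\<exists>A. k_adj_generator k H A" and hidden: "hidden_pairs H"
  shows "k_metric_dim k (join_K1 H) = k_adj_dim k H"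
proof -
  let ?J = "join_K1 H"
  interpret pair_graph H by fact
  have wf: "pair_wf_digraph ?J" by (intro pair_wf_join_K1 pair_wf_digraph)
  have mem [simp]: "None \<in> pverts ?J" "Some x \<in> pverts ?J \<longleftrightarrow> x \<in> pverts H" for x
    by (auto simp: join_K1_def)
  have d_sn: "gdist ?J (Some x) None = 1" if "x \<in> pverts H" for x
    using gdist_eqI[OF wf distance_to_join_K1_None, of "Some x"] that by simp
  have d_ns: "gdist ?J None (Some y) = 1" if "y \<in> pverts H" for y
    using gdist_eqI[OF wf distance_to_join_K1_Some, of y None] that by simp
  have d_ss: "gdist ?J (Some x) (Some y) = ereal (dist2 H x y)"
    if "x \<in> pverts H" "y \<in> pverts H" for x y
    using gdist_eqI[OF wf distance_to_join_K1_Some, of y "Some x"] that by simp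
  have trace: "{z \<in> S. gdist ?J (Some x) z \<noteq> gdist ?J (Some y) z} =
      Some ` ({z. Some z \<in> S} \<inter> adj_diff H x y)"
    if S: "S \<subseteq> pverts ?J" and xy: "x \<in> pverts H" "y \<in> pverts H" "x \<noteq> y" for S x y
  proof -
    have "gdist ?J (Some x) z \<noteq> gdist ?J (Some y) z \<longleftrightarrow>
        (\<exists>z'. z = Some z' \<and> z' \<in> adj_diff H x y)" if z: "z \<in> S" for z
    proof (cases z)
      case None
      then show ?thesis using xy by (simp add: d_sn)
    next
      case (Some z')
      then have "z' \<in> pverts H" using S z by auto
      then show ?thesis using Some xy by (auto simp: d_ss dist2_neq_iff[symmetric])
    qed
    then show ?thesis by auto
  qed
  obtain A where A: "k_adj_generator k H A" "card A = k_adj_dim k H"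
    using gen k_adj_dim_attained by metis
  have A_sub: "A \<subseteq> pverts H" using A(1) by (simp add: k_adj_generator_def)
  have finA: "finite A" using A_sub pair_finite_verts by (rule finite_subset)
  \<comment> \<open>The at least \<open>k\<close> elements of \<open>A\<close> that distinguish a pair hidden from \<open>x\<close> also tell \<open>x\<close> from the hub.\<close>
  have sep_hub: "k \<le> card {z \<in> Some ` A. gdist ?J None z \<noteq> gdist ?J (Some x) z}"
    if x: "x \<in> pverts H" for x
  proof -
    obtain a b where ab: "a \<in> pverts H" "b \<in> pverts H" "a \<noteq> b"
      "adj_diff H a b \<inter> open_nbhd H x = {}"
      using hidden x by (auto simp: hidden_pairs_def)
    have "k \<le> card (A \<inter> adj_diff H a b)"
      using A(1) ab by (simp add: k_adj_generator_def)
    also have "\<dots> = card (Some ` (A \<inter> adj_diff H a b))" by (simp add: card_image)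
    also have "\<dots> \<le> card {z \<in> Some ` A. gdist ?J None z \<noteq> gdist ?J (Some x) z}"
    proof (intro card_mono subsetI)
      fix z assume "z \<in> Some ` (A \<inter> adj_diff H a b)"
      then obtain w where w: "z = Some w" "w \<in> A" "(x, w) \<notin> parcs H"
        using ab(4) by (auto simp: open_nbhd_def)
      then have "dist2 H x w \<noteq> 1" by (simp add: dist2_def)
      then show "z \<in> {z \<in> Some ` A. gdist ?J None z \<noteq> gdist ?J (Some x) z}"
        using w x A_sub by (auto simp: d_ns d_ss one_ereal_def)
    qed (use finA in simp)
    finally show ?thesis .
  qed
  show ?thesis
  proof (rule k_metric_dim_eqI)
    show "k_metric_generator k ?J (Some ` A)"
      unfolding k_metric_generator_def
    proof (intro conjI ballI impI)
      show S_sub: "Some ` A \<subseteq> pverts ?J" using A_sub by auto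
      fix a b assume ab: "a \<in> pverts ?J" "b \<in> pverts ?J" "a \<noteq> b"
      show "k \<le> card {z \<in> Some ` A. gdist ?J a z \<noteq> gdist ?J b z}"
      proof (cases a)
        case None
        then show ?thesis using sep_hub ab by (cases b) auto
      next
        case (Some x)
        show ?thesis
        proof (cases b)
          case None
          then show ?thesis using sep_hub[of x] Some ab by (simp add: eq_commute)
        next
          case (Some y)
          then have xy: "x \<in> pverts H" "y \<in> pverts H" "x \<noteq> y"
            using ab \<open>a = Some x\<close> by auto
          have "{z. Some z \<in> Some ` A} = A" by auto
          then show ?thesis
            using trace[OF S_sub xy] A(1) xy \<open>a = Some x\<close> Some
            by (simp add: k_adj_generator_def card_image)
        qed
      qed
    qed
    show "card (Some ` A) = k_adj_dim k H" using A(2) by (simp add: card_image)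
  next
    fix T assume T: "k_metric_generator k ?J T"
    let ?B = "{z. Some z \<in> T}"
    have T_sub: "T \<subseteq> pverts ?J" using T by (simp add: k_metric_generator_def)
    have finT: "finite T"
      by (rule finite_subset[OF T_sub]) (simp add: join_K1_def pair_finite_verts)
    have "k_adj_generator k H ?B"
      unfolding k_adj_generator_def
    proof (intro conjI ballI impI)
      fix x y assume xy: "x \<in> pverts H" "y \<in> pverts H" "x \<noteq> y"
      have "k \<le> card {z \<in> T. gdist ?J (Some x) z \<noteq> gdist ?J (Some y) z}"
        using T xy by (simp add: k_metric_generator_def)
      then show "k \<le> card (?B \<inter> adj_diff H x y)"
        using trace[OF T_sub xy] by (simp add: card_image)
    qed (use T_sub in auto)
    then have "k_adj_dim k H \<le> card ?B" by (rule k_adj_dim_le)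
    also have "\<dots> = card (Some ` ?B)" by (simp add: card_image)
    also have "\<dots> \<le> card T" using finT by (intro card_mono) auto
    finally show "k_adj_dim k H \<le> card T" .
  qed
qed

section \<open>Graphs with hidden pairs\<close>

text \<open>
  Being joined by a walk of length one or two; a vertex is therefore near itself as soon as
  it has a neighbour.
\<close>

definition near :: "'a pair_pre_digraph \<Rightarrow> 'a \<Rightarrow> 'a \<Rightarrow> bool" where
  "near H x a \<longleftrightarrow> (x, a) \<in> parcs H \<union> parcs H O parcs H"

text \<open>
  A vertex of \<open>N(x)\<close> that equals \<open>a\<close> or is adjacent to \<open>a\<close> makes \<open>a\<close> near \<open>x\<close>.
\<close>

lemma hidden_pairsI:
  assumes H: "pair_graph H"
    and far: "\<And>x. x \<in> pverts H \<Longrightarrow>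
      \<exists>a \<in> pverts H. \<exists>b \<in> pverts H. a \<noteq> b \<and> \<not> near H x a \<and> \<not> near H x b"
  shows "hidden_pairs H"
  unfolding hidden_pairs_def
proof
  interpret pair_graph H by fact
  have disj: "adj_diff H a b \<inter> open_nbhd H x = {}" if "\<not> near H x a" "\<not> near H x b" for a b x
    using that by (auto simp: near_def adj_diff_def open_nbhd_def dest: arcs_symmetric)
  fix x assume "x \<in> pverts H"
  then show "\<exists>a \<in> pverts H. \<exists>b \<in> pverts H. a \<noteq> b \<and> adj_diff H a b \<inter> open_nbhd H x = {}"
    using far disj by meson
qed

lemma near_relpow:
  assumes "near H x a"
  obtains n where "n \<le> 2" "(x, a) \<in> parcs H ^^ n"
proof (cases "(x, a) \<in> parcs H")
  case True
  then show ?thesis using that[of 1] by simp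
next
  case False
  then show ?thesis using that[of 2] assms by (auto simp: near_def numeral_2_eq_2)
qed

lemma sym_relpow:
  assumes "sym R"
  shows "sym (R ^^ n)"
proof (induct n)
  case (Suc n)
  show ?case
  proof (rule symI)
    fix x y assume "(x, y) \<in> R ^^ Suc n"
    then obtain z where "(x, z) \<in> R ^^ n" "(z, y) \<in> R" by auto
    then have "(z, x) \<in> R ^^ n" "(y, z) \<in> R" using Suc assms by (auto dest: symD)
    then show "(y, x) \<in> R ^^ Suc n" by (metis relpow_Suc_I2)
  qed
qed (simp add: sym_def)

text \<open>
  Let \<open>u\<close> and \<open>v\<close> have distance at least \<open>6\<close>. If \<open>x\<close> is near neither of them, they are the pair. If
  it is near one end \<open>s\<close>, then the other end \<open>t\<close> and a neighbour \<open>b\<close> of \<open>t\<close> are not near \<open>x\<close>, as they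
  would give a walk from \<open>s\<close> to \<open>t\<close> of length at most \<open>2 + 2 + 1 = 5\<close>.
\<close>

lemma hidden_pairs_diameter:
  assumes H: "pair_graph H" "connected (with_proj H)" and diam: "6 \<le> gdiameter H"
  shows "hidden_pairs H"
proof (rule hidden_pairsI[OF H(1)])
  interpret pair_graph H by fact
  have wf: "pair_wf_digraph H" by (rule pair_wf_digraph)
  have near_sym: "near H a b \<Longrightarrow> near H b a" for a b
    by (auto simp: near_def dest: arcs_symmetric)
  have "(5 :: ereal) < 6" by simp
  then have "5 < gdiameter H" using diam by (rule less_le_trans)
  then obtain u v where uv: "u \<in> pverts H" "v \<in> pverts H" "5 < gdist H u v"
    by (auto simp: gdiameter_def less_SUP_iff)
  have long: "5 < n" if "(u, v) \<in> parcs H ^^ n" for n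
  proof -
    have "ereal 5 < ereal (real n)"
      using less_le_trans[OF uv(3) gdist_le_relpow[OF wf that uv(1)]] by simp
    then show ?thesis by simp
  qed
  have long': "5 < n" if "(v, u) \<in> parcs H ^^ n" for n
  proof (rule long)
    have "sym (parcs H)" by (auto simp: sym_def dest: arcs_symmetric)
    then have "sym (parcs H ^^ n)" by (rule sym_relpow)
    then show "(u, v) \<in> parcs H ^^ n" using that by (rule symD)
  qed
  have ne: "u \<noteq> v" using long[of 0] by auto
  fix x assume x: "x \<in> pverts H"
  have one_end: "\<exists>a \<in> pverts H. \<exists>b \<in> pverts H. a \<noteq> b \<and> \<not> near H x a \<and> \<not> near H x b"
    if s: "s \<in> pverts H" "t \<in> pverts H" "s \<noteq> t" and
      long: "\<And>n. (s, t) \<in> parcs H ^^ n \<Longrightarrow> 5 < n" and near: "near H x s" for s t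
  proof -
    \<comment> \<open>The last step of a walk from \<open>s\<close> supplies the neighbour.\<close>
    obtain b where b: "(b, t) \<in> parcs H"
      using connected_rtrancl[OF H s(1,2)] s(3) by (auto elim: rtranclE)
    obtain n where n: "n \<le> 2" "(s, x) \<in> parcs H ^^ n"
      using near_relpow near_sym[OF near] by metis
    have "\<not> near H x t"
    proof
      assume "near H x t"
      then obtain m where m: "m \<le> 2" "(x, t) \<in> parcs H ^^ m" by (rule near_relpow)
      have "(s, t) \<in> parcs H ^^ (n + m)" using n m by (auto simp: relpow_add)
      then show False using long n m by fastforce
    qed
    moreover have "\<not> near H x b"
    proof
      assume "near H x b"
      then obtain m where m: "m \<le> 2" "(x, b) \<in> parcs H ^^ m" by (rule near_relpow)
      then have "(x, t) \<in> parcs H ^^ Suc m" using b by auto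
      then have "(s, t) \<in> parcs H ^^ (n + Suc m)" using n unfolding relpow_add by blast
      then show False using long n m by fastforce
    qed
    moreover have "b \<in> pverts H" "b \<noteq> t" using b by (auto dest: in_arcsD1 no_loops')
    ultimately show ?thesis using s by blast
  qed
  show "\<exists>a \<in> pverts H. \<exists>b \<in> pverts H. a \<noteq> b \<and> \<not> near H x a \<and> \<not> near H x b"
    using one_end[of u v] one_end[of v u] long long' ne uv by blast
qed

lemma mod_add_less:
  fixes i j m :: nat
  assumes "i < m" "j < m"
  shows "(i + j) mod m = (if i + j < m then i + j else i + j - m)"
  using assms by (simp add: le_mod_geq)

text \<open>
  Both ways around the cycle, the offsets \<open>3\<close> and \<open>4\<close> are at least three steps: \<open>7 - 4 = 3\<close>
  is where the bound on the length comes from.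
\<close>

lemma cycle_graph_not_near:
  assumes "7 \<le> m" "i < m" "j = 3 \<or> j = 4"
  shows "\<not> near (cycle_graph m) i ((i + j) mod m)"
proof
  have arc: "Suc a = b \<or> Suc b = a \<or> a = 0 \<and> Suc b = m \<or> b = 0 \<and> Suc a = m"
    if "(a, b) \<in> parcs (cycle_graph m)" for a b
  proof -
    have "a < m" "b < m" "b = Suc a mod m \<or> a = Suc b mod m"
      using that by (auto simp: cycle_graph_def)
    then show ?thesis
      by (cases "Suc a = m"; cases "Suc b = m") auto
  qed
  define l where "l = (i + j) mod m"
  have l: "l = i + j \<or> l + m = i + j"
    using assms by (auto simp: l_def mod_add_less split: if_splits)
  assume "near (cycle_graph m) i ((i + j) mod m)"
  then consider "(i, l) \<in> parcs (cycle_graph m)"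
    | c where "(i, c) \<in> parcs (cycle_graph m)" "(c, l) \<in> parcs (cycle_graph m)"
    by (auto simp: near_def l_def)
  then show False
  proof cases
    case 1
    show False using arc[OF 1] l assms by - (elim disjE conjE; linarith)
  next
    case 2
    show False using arc[OF 2(1)] arc[OF 2(2)] l assms by - (elim disjE conjE; linarith)
  qed
qed

lemma hidden_pairs_cycle:
  assumes H: "pair_graph H" and m: "7 \<le> m"
    and iso: "digraph_iso (with_proj H) (with_proj (cycle_graph m))"
  shows "hidden_pairs H"
proof (rule hidden_pairsI[OF H])
  obtain \<phi> where \<phi>: "pre_digraph.digraph_isomorphism (with_proj H) \<phi>"
    and eq: "with_proj (cycle_graph m) = app_iso \<phi> (with_proj H)"
    using iso by (auto simp: digraph_iso_def)
  let ?h = "iso_verts \<phi>"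
  have img: "?h ` pverts H = {0..<m}"
    using arg_cong[OF eq, of verts] by (simp add: cycle_graph_def)
  have arcs: "(?h x, ?h y) \<in> parcs (cycle_graph m)" if xy: "(x, y) \<in> parcs H" for x y
  proof -
    have "iso_arcs \<phi> ` parcs H = parcs (cycle_graph m)"
      using arg_cong[OF eq, of arcs] by simp
    then have "iso_arcs \<phi> (x, y) \<in> parcs (cycle_graph m)"
      using xy by blast
    moreover have "iso_arcs \<phi> (x, y) = (?h x, ?h y)"
    proof (rule prod_eqI)
      have "?h x = iso_tail \<phi> (iso_arcs \<phi> (x, y))" "?h y = iso_head \<phi> (iso_arcs \<phi> (x, y))"
        using \<phi> xy by (force simp: pre_digraph.digraph_isomorphism_def)+
      moreover have "iso_tail \<phi> = fst" "iso_head \<phi> = snd"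
        using arg_cong[OF eq, of tail] arg_cong[OF eq, of head] by simp_all
      ultimately show "fst (iso_arcs \<phi> (x, y)) = fst (?h x, ?h y)"
        "snd (iso_arcs \<phi> (x, y)) = snd (?h x, ?h y)"
        by simp_all
    qed
    ultimately show ?thesis by simp
  qed
  have near: "near (cycle_graph m) (?h x) (?h y)" if xy: "near H x y" for x y
  proof (cases "(x, y) \<in> parcs H")
    case True
    then show ?thesis using arcs by (simp add: near_def)
  next
    case False
    then obtain z where "(x, z) \<in> parcs H" "(z, y) \<in> parcs H"
      using xy by (auto simp: near_def)
    then have "(?h x, ?h y) \<in> parcs (cycle_graph m) O parcs (cycle_graph m)"
      using arcs by (intro relcompI)
    then show ?thesis by (simp add: near_def)
  qed
  fix x assume x: "x \<in> pverts H"
  define i where "i = ?h x"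
  have "i \<in> {0..<m}" unfolding img[symmetric] i_def using x by (rule imageI)
  then have i: "i < m" by simp
  have onto: "\<exists>a \<in> pverts H. j mod m = ?h a" for j
  proof -
    have "j mod m \<in> ?h ` pverts H" unfolding img using m by simp
    then show ?thesis by (simp add: image_iff)
  qed
  obtain a b where ab: "a \<in> pverts H" "?h a = (i + 3) mod m"
    "b \<in> pverts H" "?h b = (i + 4) mod m"
    using onto[of "i + 3"] onto[of "i + 4"] by auto
  have "\<not> near H x a" "\<not> near H x b"
    using near[of x a] near[of x b] cycle_graph_not_near[OF m i, of 3]
      cycle_graph_not_near[OF m i, of 4] ab by (auto simp: i_def)
  moreover have "(i + 3) mod m \<noteq> (i + 4) mod m"
    using i m by (auto simp: mod_add_less split: if_splits)
  then have "a \<noteq> b" using ab by auto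
  ultimately show "\<exists>a \<in> pverts H. \<exists>b \<in> pverts H. a \<noteq> b \<and> \<not> near H x a \<and> \<not> near H x b"
    using ab by blast
qed

section \<open>The dimension formula\<close>

theorem theorem35:
  fixes G :: "'a pair_pre_digraph" and H :: "'a \<Rightarrow> 'b pair_pre_digraph" and k :: nat
  assumes "pair_graph G" and "connected (with_proj G)" and "2 \<le> card (pverts G)"
    and "\<And>v. v \<in> pverts G \<Longrightarrow> pair_graph (H v)"
    and "\<And>v. v \<in> pverts G \<Longrightarrow> connected (with_proj (H v))"
    and "\<And>v. v \<in> pverts G \<Longrightarrow> 2 \<le> card (pverts (H v))"
    and "\<And>v. v \<in> pverts G \<Longrightarrow>
      6 \<le> gdiameter (H v) \<or>
      (\<exists>m \<ge> 7. digraph_iso (with_proj (H v)) (with_proj (cycle_graph m)))"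
    and "k \<in> {1..C_family (pverts G) H}"
  shows "k_metric_dim k (corona G H) = k_metric_dim k (corona G (\<lambda>v. gcomplement (H v))) \<and>
    k_metric_dim k (corona G (\<lambda>v. gcomplement (H v))) =
      (\<Sum>v \<in> pverts G. k_metric_dim k (join_K1 (H v)))"
proof -
  have "finite (pverts G)" using assms(3) by (auto intro: card_ge_0_finite)
  then have "k \<le> C_graph (H v)" if "v \<in> pverts G" for v
    using assms(8) that unfolding C_family_def by (meson Min_le atLeastAtMost_iff finite_imageI imageI le_trans)
  then have gen: "\<exists>A. k_adj_generator k (H v) A" if "v \<in> pverts G" for v
    using that k_adj_generator_pverts assms(4) by blast
  have "k_metric_dim k (corona G H) = (\<Sum>v \<in> pverts G. k_adj_dim k (H v))"
    using assms(1-4,6) gen by (intro k_metric_dim_corona)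
  moreover have "k_metric_dim k (corona G (\<lambda>v. gcomplement (H v))) =
      (\<Sum>v \<in> pverts G. k_adj_dim k (gcomplement (H v)))"
    using assms(1-4,6) gen
    by (intro k_metric_dim_corona)
      (auto simp: pair_graph_gcomplement k_adj_generator_gcomplement)
  moreover have "k_adj_dim k (gcomplement (H v)) = k_adj_dim k (H v)" if "v \<in> pverts G" for v
    using assms(4)[OF that] by (simp add: k_adj_dim_def k_adj_generator_gcomplement)
  moreover have "k_metric_dim k (join_K1 (H v)) = k_adj_dim k (H v)" if "v \<in> pverts G" for v
    using assms(4,5,7)[OF that] gen[OF that]
    by (intro k_metric_dim_join_K1) (auto intro: hidden_pairs_diameter hidden_pairs_cycle)
  ultimately show ?thesis by simp
qed

end
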